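(* There is no function $\alpha:\mathbb{N}\rightarrow\mathbb{N}$ such that every finite metric space can be embedded into $\ell_\infty$ with prioritized dimension $\alpha$ and distortion $t$, for any fixed $t<\frac{3}{2}$.
   Context: An embedding $f:X\to\ell_\infty$ of a metric space $(X,d)$ has distortion $t\ge1$ if $d(x,y)\le\|f(x)-f(y)\|_\infty\le t\cdot d(x,y)$ for all $x,y\in X$. Given a priority ordering $X=\{x_1,\dots,x_n\}$, the embedding $f$ has prioritized dimension $\alpha:\mathbb{N}\to\mathbb{N}$ if $f(x_j)$ is non-zero only in its first $\alpha(j)$ coordinates, i.e. $f_i(x_j)=0$ whenever $i>\alpha(j)$. The function $\alpha$ must work for every finite metric space and every priority ordering; it may not depend on $n=|X|$. *)

theory Defs
  imports "HOL-Analysis.Analysis"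
begin

text \<open>
  As \<open>nat\<close> carries the discrete topology, the bounded continuous functions \<open>nat \<Rightarrow>\<^sub>C real\<close> with
  their supremum norm are exactly the real sequence space \<open>\<ell>\<^sub>\<infinity>\<close>. Coordinates are counted from 0.
\<close>
type_synonym linf = "nat \<Rightarrow>\<^sub>C real"

definition has_distortion :: "'a set \<Rightarrow> ('a \<Rightarrow> 'a \<Rightarrow> real) \<Rightarrow> ('a \<Rightarrow> linf) \<Rightarrow> real \<Rightarrow> bool" where
  "has_distortion X d f t \<longleftrightarrow>
     (\<forall>x\<in>X. \<forall>y\<in>X. d x y \<le> norm (f x - f y) \<and> norm (f x - f y) \<le> t * d x y)"

text \<open>Only the values \<open>p 1, \<dots>, p (card X)\<close> are relevant; they list each point of \<open>X\<close> once.\<close>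
definition priority_ordering :: "'a set \<Rightarrow> (nat \<Rightarrow> 'a) \<Rightarrow> bool" where
  "priority_ordering X p \<longleftrightarrow> bij_betw p {1..card X} X"

text \<open>
  With coordinates counted from 0, the first \<open>\<alpha> j\<close> coordinates are those with index \<open>i < \<alpha> j\<close>.
\<close>
definition has_prioritized_dimension ::
    "'a set \<Rightarrow> (nat \<Rightarrow> 'a) \<Rightarrow> ('a \<Rightarrow> linf) \<Rightarrow> (nat \<Rightarrow> nat) \<Rightarrow> bool" where
  "has_prioritized_dimension X p f \<alpha> \<longleftrightarrow>
     (\<forall>j\<in>{1..card X}. \<forall>i\<ge>\<alpha> j. apply_bcontfun (f (p j)) i = 0)"

definition prioritized_embeddable ::
    "'a set \<Rightarrow> ('a \<Rightarrow> 'a \<Rightarrow> real) \<Rightarrow> (nat \<Rightarrow> nat) \<Rightarrow> real \<Rightarrow> bool" where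
  "prioritized_embeddable X d \<alpha> t \<longleftrightarrow>
     (\<forall>p. priority_ordering X p \<longrightarrow>
        (\<exists>f. has_prioritized_dimension X p f \<alpha> \<and> has_distortion X d f t))"

text \<open>
  HOL cannot quantify over types inside a formula. The following lemma shows that nothing is lost
  by letting \<open>every finite metric space\<close> range over the finite metric spaces whose points
  are natural numbers.
\<close>
lemma prioritized_embeddable_nat_imp_all:
  fixes X :: "'a set"
  assumes nat: "\<And>(Y :: nat set) e. finite Y \<Longrightarrow> Metric_space Y e \<Longrightarrow> prioritized_embeddable Y e \<alpha> t"
    and X: "finite X" "Metric_space X d"
  shows "prioritized_embeddable X d \<alpha> t"
  unfolding prioritized_embeddable_def
proof (intro allI impI)
  fix p assume "priority_ordering X p"
  then have p: "bij_betw p {1..card X} X"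
    by (simp add: priority_ordering_def)
  interpret X: Metric_space X d by fact
  define Y where "Y = {1..card X}"
  define e where "e = (\<lambda>i j. if i \<in> Y \<and> j \<in> Y then d (p i) (p j) else 0)"
  have inj: "inj_on p Y" and img: "X = p ` Y"
    using bij_betw_imp_inj_on[OF p] bij_betw_imp_surj_on[OF p] unfolding Y_def by blast+
  have pX: "p i \<in> X" if "i \<in> Y" for i
    unfolding img using that by (rule imageI)
  have p_eq: "p i = p j \<longleftrightarrow> i = j" if "i \<in> Y" "j \<in> Y" for i j
    using inj_on_eq_iff[OF inj that] .
  have "Metric_space Y e"
  proof
    show "0 \<le> e i j" for i j
      by (simp add: e_def)
    show "e i j = e j i" for i j
      by (simp add: e_def X.commute[of "p i"])
    show "e i j = 0 \<longleftrightarrow> i = j" if "i \<in> Y" "j \<in> Y" for i j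
      using that by (simp add: e_def pX p_eq)
    show "e i k \<le> e i j + e j k" if "i \<in> Y" "j \<in> Y" "k \<in> Y" for i j k
      using that by (simp add: e_def pX X.triangle)
  qed
  moreover have "finite Y" and card: "card Y = card X"
    by (auto simp: Y_def)
  moreover have "priority_ordering Y (\<lambda>i. i)"
    by (simp add: priority_ordering_def Y_def bij_betw_def)
  ultimately obtain g where g: "has_prioritized_dimension Y (\<lambda>i. i) g \<alpha>" "has_distortion Y e g t"
    using nat unfolding prioritized_embeddable_def by blast
  define f where "f = g \<circ> inv_into Y p"
  have inv: "inv_into Y p (p i) = i" if "i \<in> Y" for i
    using inv_into_f_f[OF inj that] .
  have "has_prioritized_dimension X p f \<alpha>"
    using g(1) inv unfolding has_prioritized_dimension_def f_def card Y_def[symmetric] by simp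
  moreover have "has_distortion X d f t"
    using g(2) inv unfolding has_distortion_def f_def img by (simp add: e_def)
  ultimately show "\<exists>f. has_prioritized_dimension X p f \<alpha> \<and> has_distortion X d f t"
    by blast
qed

end

theory Submission imports Defs begin

text \<open>
  Let \<open>u\<close>, \<open>v\<close> have the two highest priorities and add points \<open>x\<^sub>i\<close>, \<open>y\<^sub>i\<close> with
  \<open>d(u, x\<^sub>i) = d(v, y\<^sub>i) = 1\<close>, \<open>d(x\<^sub>i, y\<^sub>i) = 3\<close>, and all other distances equal to \<open>2\<close>. Both
  \<open>f(u)\<close> and \<open>f(v)\<close> vanish outside the first \<open>D = max (\<alpha> 1) (\<alpha> 2)\<close> coordinates, so there
  \<open>f(x\<^sub>i)\<close> and \<open>f(y\<^sub>i)\<close> are at most \<open>t\<close> in absolute value and differ by at most \<open>2 t < 3\<close>.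
  Hence the distance \<open>3\<close> is attained within the first \<open>D\<close> coordinates. If there are enough points,
  some \<open>f(x\<^sub>i)\<close> and \<open>f(x\<^sub>j)\<close> with \<open>i \<noteq> j\<close> almost agree on these coordinates, which contradicts
  \<open>\<parallel>f(x\<^sub>j) - f(y\<^sub>i)\<parallel> \<le> 2 t < 3\<close>.
\<close>

text \<open>The points \<open>u, v, x\<^sub>i, y\<^sub>i\<close> are encoded as \<open>0, 1, 2 * i + 2, 2 * i + 3\<close>.\<close>

definition matching_dist :: "nat \<Rightarrow> nat \<Rightarrow> real" where
  "matching_dist m n =
     (if m = n then 0
      else if m div 2 = n div 2 \<and> 2 \<le> m then 3
      else if (m < 2 \<or> n < 2) \<and> (even m \<longleftrightarrow> even n) then 1
      else 2)"

lemma matching_dist_commute: "matching_dist m n = matching_dist n m"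
proof -
  have "2 \<le> m \<longleftrightarrow> 2 \<le> n" if "m div 2 = n div 2"
    using that by presburger
  then show ?thesis
    unfolding matching_dist_def by auto
qed

lemma eq_if_div2_parity_eq:
  fixes m n :: nat
  shows "m div 2 = n div 2 \<Longrightarrow> (even m \<longleftrightarrow> even n) \<Longrightarrow> m = n"
  by (metis bit_eq_rec)

text \<open>Distinct points are at distance 1, 2 or 3, so only the distance 3 of a matched pair is
  critical. A detour of length 1 + 1 would need a point at distance 1 from both, but only
  \<open>0\<close> and \<open>1\<close> have neighbours at distance 1, of their own parity, and
  matched points differ in parity.\<close>

lemma matching_dist_triangle: "matching_dist m k \<le> matching_dist m n + matching_dist n k"
proof -
  have self: "matching_dist i i = 0" and nonneg: "0 \<le> matching_dist i j" for i j
    by (simp_all add: matching_dist_def)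
  have ge1: "1 \<le> matching_dist i j" if "i \<noteq> j" for i j
    using that by (simp add: matching_dist_def)
  have le3: "matching_dist i j \<le> 3" for i j
    by (simp add: matching_dist_def)
  have le2: "matching_dist i j \<le> 2" if "\<not> (i div 2 = j div 2 \<and> 2 \<le> i)" for i j
    using that by (auto simp: matching_dist_def)
  consider "m = n \<or> n = k" | "m = k" | "m \<noteq> n" "n \<noteq> k" "m \<noteq> k" "matching_dist m k \<le> 2"
    | "m \<noteq> n" "n \<noteq> k" "m \<noteq> k" "m div 2 = k div 2" "2 \<le> m"
    using le2[of m k] by argo
  then show ?thesis
  proof cases
    case 1
    then show ?thesis using self by auto
  next
    case 2
    then show ?thesis using self nonneg by simp
  next
    case 3
    then show ?thesis using ge1[of m n] ge1[of n k] by linarith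
  next
    case 4
    have "2 \<le> k"
      using 4(4,5) by presburger
    have parity: "even m \<longleftrightarrow> odd k"
      using 4(3,4) eq_if_div2_parity_eq by blast
    \<comment> \<open>Each value of \<open>div 2\<close> is taken by just two numbers, here
      \<open>m\<close> and \<open>k\<close>.\<close>
    have "m div 2 \<noteq> n div 2"
      using 4(1,2,4) parity eq_if_div2_parity_eq[of m n] eq_if_div2_parity_eq[of n k] by argo
    then have "matching_dist m n =
        (if n < 2 \<and> (even m \<longleftrightarrow> even n) then 1 else 2)"
      "matching_dist n k = (if n < 2 \<and> (even n \<longleftrightarrow> even k) then 1 else 2)"
      using 4(1,2,5) \<open>2 \<le> k\<close> 4(4)[symmetric] by (simp_all add: matching_dist_def)
    then have "matching_dist m n + matching_dist n k \<ge> 3"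
      using parity by simp
    then show ?thesis using le3[of m k] by linarith
  qed
qed

lemma Metric_space_matching_dist: "Metric_space X matching_dist"
proof
  show "0 \<le> matching_dist m n" for m n
    by (simp add: matching_dist_def)
  show "matching_dist m n = 0 \<longleftrightarrow> m = n" for m n
    by (simp add: matching_dist_def)
qed (rule matching_dist_commute matching_dist_triangle)+

text \<open>Pigeonhole: a grid of mesh \<open>\<epsilon>\<close> cuts the cube of radius
  \<open>t\<close> into finitely many cells. Their number does not depend on \<open>g\<close>, so
  \<open>N\<close> can be fixed before the embedding is known.\<close>

lemma exists_close_pair:
  fixes t \<epsilon> :: real and D :: nat
  assumes "0 < \<epsilon>"
  obtains N where "\<And>g :: nat \<Rightarrow> nat \<Rightarrow> real. (\<And>i c. i < N \<Longrightarrow> c < D \<Longrightarrow> \<bar>g i c\<bar> \<le> t) \<Longrightarrow>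
    \<exists>i<N. \<exists>j<N. i \<noteq> j \<and> (\<forall>c<D. \<bar>g i c - g j c\<bar> \<le> \<epsilon>)"
proof
  define B where "B = (\<Pi>\<^sub>E c\<in>{..<D}. {\<lfloor>- t / \<epsilon>\<rfloor>..\<lfloor>t / \<epsilon>\<rfloor>})"
  have "finite B"
    by (simp add: B_def finite_PiE)
  fix g :: "nat \<Rightarrow> nat \<Rightarrow> real"
  assume bound: "\<And>i c. i < Suc (card B) \<Longrightarrow> c < D \<Longrightarrow> \<bar>g i c\<bar> \<le> t"
  \<comment> \<open>The grid cell of the \<open>i\<close>-th point; restricting to
    \<open>{..<D}\<close> makes it an element of \<open>B\<close>.\<close>
  define h where "h = (\<lambda>i. \<lambda>c\<in>{..<D}. \<lfloor>g i c / \<epsilon>\<rfloor>)"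
  have "h ` {..<Suc (card B)} \<subseteq> B"
  proof (intro image_subsetI)
    fix i assume i: "i \<in> {..<Suc (card B)}"
    have "\<lfloor>- t / \<epsilon>\<rfloor> \<le> \<lfloor>g i c / \<epsilon>\<rfloor> \<and> \<lfloor>g i c / \<epsilon>\<rfloor> \<le> \<lfloor>t / \<epsilon>\<rfloor>" if "c < D" for c
    proof -
      have "- t \<le> g i c" "g i c \<le> t"
        using bound[of i c] i that by (auto simp: abs_le_iff)
      then show ?thesis
        using assms by (intro conjI floor_mono divide_right_mono) auto
    qed
    then show "h i \<in> B"
      by (auto simp: h_def B_def)
  qed
  then have "\<not> inj_on h {..<Suc (card B)}"
    using card_inj_on_le[of h _ B] \<open>finite B\<close> by fastforce
  then obtain i j where ij: "i < Suc (card B)" "j < Suc (card B)" "i \<noteq> j" "h i = h j"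
    by (auto simp: inj_on_def)
  have "\<bar>g i c - g j c\<bar> \<le> \<epsilon>" if "c < D" for c
  proof -
    have "\<lfloor>g i c / \<epsilon>\<rfloor> = \<lfloor>g j c / \<epsilon>\<rfloor>"
      using fun_cong[OF ij(4), of c] that by (simp add: h_def)
    then have "\<bar>g i c / \<epsilon> - g j c / \<epsilon>\<bar> \<le> 1"
      by linarith
    moreover have "g i c / \<epsilon> - g j c / \<epsilon> = (g i c - g j c) / \<epsilon>"
      by (simp add: diff_divide_distrib)
    ultimately show ?thesis
      using assms by (simp add: field_simps)
  qed
  with ij show "\<exists>i<Suc (card B). \<exists>j<Suc (card B). i \<noteq> j \<and> (\<forall>c<D. \<bar>g i c - g j c\<bar> \<le> \<epsilon>)"
    by blast
qed

theorem theorem2p2: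
  fixes t :: real
  assumes "1 \<le> t" and "t < 3 / 2"
  shows "\<not> (\<exists>\<alpha> :: nat \<Rightarrow> nat. \<forall>(X :: nat set) d.
             finite X \<longrightarrow> Metric_space X d \<longrightarrow> prioritized_embeddable X d \<alpha> t)"
proof
  assume "\<exists>\<alpha> :: nat \<Rightarrow> nat. \<forall>(X :: nat set) d.
            finite X \<longrightarrow> Metric_space X d \<longrightarrow> prioritized_embeddable X d \<alpha> t"
  then obtain \<alpha> :: "nat \<Rightarrow> nat" where
    embeddable: "\<And>(X :: nat set) d. finite X \<Longrightarrow> Metric_space X d \<Longrightarrow> prioritized_embeddable X d \<alpha> t"
    by blast
  define D where "D = max (\<alpha> 1) (\<alpha> 2)"
  \<comment> \<open>Half of the gap between \<open>2 * t\<close> and 3, which keeps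
    \<open>2 * t + \<epsilon>\<close> strictly below 3.\<close>
  define \<epsilon> where "\<epsilon> = (3 - 2 * t) / 2"
  have \<epsilon>: "0 < \<epsilon>" "2 * t + \<epsilon> < 3"
    using assms by (auto simp: \<epsilon>_def field_simps)
  obtain N where N: "\<And>g :: nat \<Rightarrow> nat \<Rightarrow> real. (\<And>i c. i < N \<Longrightarrow> c < D \<Longrightarrow> \<bar>g i c\<bar> \<le> t) \<Longrightarrow>
    \<exists>i<N. \<exists>j<N. i \<noteq> j \<and> (\<forall>c<D. \<bar>g i c - g j c\<bar> \<le> \<epsilon>)"
    using exists_close_pair[OF \<epsilon>(1), of D t] by metis
  define X where "X = {..<2 * N + 2}"
  \<comment> \<open>Priorities start at 1 and points at 0, so \<open>0\<close> and \<open>1\<close>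
    get priorities 1 and 2, as the choice of \<open>D\<close> requires.\<close>
  have "bij_betw (\<lambda>j. j - 1) {1..card X} X"
    by (rule bij_betw_byWitness[where f' = Suc]) (auto simp: X_def)
  moreover have "prioritized_embeddable X matching_dist \<alpha> t"
    by (intro embeddable Metric_space_matching_dist) (simp add: X_def)
  ultimately obtain f where dim: "has_prioritized_dimension X (\<lambda>j. j - 1) f \<alpha>"
    and dist: "has_distortion X matching_dist f t"
    unfolding prioritized_embeddable_def priority_ordering_def by blast
  have upper: "\<bar>apply_bcontfun (f m) c - apply_bcontfun (f n) c\<bar> \<le> t * matching_dist m n"
    if "m \<in> X" "n \<in> X" for m n c
  proof -
    have "\<bar>apply_bcontfun (f m) c - apply_bcontfun (f n) c\<bar> \<le> norm (f m - f n)"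
      using norm_bounded[of "f m - f n" c] by simp
    also have "\<dots> \<le> t * matching_dist m n"
      using dist that by (simp add: has_distortion_def)
    finally show ?thesis .
  qed
  have zero: "apply_bcontfun (f 0) c = 0" "apply_bcontfun (f 1) c = 0" if "D \<le> c" for c
  proof -
    have "1 \<in> {1..card X}" "2 \<in> {1..card X}" "\<alpha> 1 \<le> c" "\<alpha> 2 \<le> c"
      using that by (auto simp: X_def D_def)
    then show "apply_bcontfun (f 0) c = 0" "apply_bcontfun (f 1) c = 0"
      using dim unfolding has_prioritized_dimension_def by fastforce+
  qed
  have x: "\<bar>apply_bcontfun (f (2 * i + 2)) c - apply_bcontfun (f 0) c\<bar> \<le> t"
    and y: "\<bar>apply_bcontfun (f (2 * i + 3)) c - apply_bcontfun (f 1) c\<bar> \<le> t" if "i < N" for i c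
    using upper[of "2 * i + 2" 0 c] upper[of "2 * i + 3" 1 c] that
    by (auto simp: X_def matching_dist_def)
  obtain i j where "i < N" "j < N" "i \<noteq> j" and close: "\<And>c. c < D \<Longrightarrow>
    \<bar>apply_bcontfun (f (2 * i + 2)) c - apply_bcontfun (f (2 * j + 2)) c\<bar> \<le> \<epsilon>"
    \<comment> \<open>Subtracting \<open>f 0\<close> gives the bound \<open>t\<close>; the shift
      cancels in the differences.\<close>
    using N[of "\<lambda>i c. apply_bcontfun (f (2 * i + 2)) c - apply_bcontfun (f 0) c", OF x] by auto
  have "norm (f (2 * i + 2) - f (2 * i + 3)) \<le> 2 * t + \<epsilon>"
  proof (rule norm_bound)
    fix c
    show "norm (apply_bcontfun (f (2 * i + 2) - f (2 * i + 3)) c) \<le> 2 * t + \<epsilon>"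
    proof (cases "c < D")
      case True
      have "matching_dist (2 * j + 2) (2 * i + 3) = 2"
        using \<open>i \<noteq> j\<close> by (simp add: matching_dist_def)
      then have "\<bar>apply_bcontfun (f (2 * j + 2)) c - apply_bcontfun (f (2 * i + 3)) c\<bar> \<le> 2 * t"
        using upper[of "2 * j + 2" "2 * i + 3" c] \<open>i < N\<close> \<open>j < N\<close> by (simp add: X_def)
      with close[OF True] show ?thesis
        by simp
    next
      case False
      then show ?thesis
        using x[OF \<open>i < N\<close>, of c] y[OF \<open>i < N\<close>, of c] zero[of c] \<epsilon>(1) by simp
    qed
  qed
  moreover have "matching_dist (2 * i + 2) (2 * i + 3) = 3"
    by (simp add: matching_dist_def)
  moreover have "2 * i + 2 \<in> X" "2 * i + 3 \<in> X"
    using \<open>i < N\<close> by (auto simp: X_def)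
  then have "matching_dist (2 * i + 2) (2 * i + 3) \<le> norm (f (2 * i + 2) - f (2 * i + 3))"
    using dist unfolding has_distortion_def by blast
  ultimately show False
    using \<epsilon>(2) by linarith
qed

end
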